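(* Assume that the chain $\Phi$ with transition kernel $P$ on $(X,\mathcal{B}(X))$ is $\psi$-irreducible, and that $\mathbb{P}_x\{\tau<\infty\}=1$ for all $x\in X$, where $\tau=\sup\{n\geq0:\Phi_n\in X\}$. Then the following statements are equivalent. (1) The chain $\Phi$ is strongly geometric transient. (2) For $x\in X$, there exists a constant $\kappa>1$ such that $\mathbb{E}_x[\kappa^{\tau}]<\infty$. (3) There exist some constant $\lambda\in(0,1)$ and a finite function $W\geq1$ such that $$PW(x)\leq\lambda W(x),\qquad x\in X.$$
   Context: Setting: $\Phi=\{\Phi_n:n\in\mathbb{Z}_+\}$ is a discrete-time homogeneous Markov chain on a general state space $X$ with a countably generated $\sigma$-field $\mathcal{B}(X)$. $P^n(x,A)=\mathbb{P}_x\{\Phi_n\in A\}$ is its $n$-step transition kernel; $P$ may be stochastic or sub-stochastic, and in the sub-stochastic case the chain may leave ("escape" from) $X$, after which it never returns; $\tau=\sup\{n\ge0:\Phi_n\in X\}$ is the last time the chain is in $X$. $\mathbb{P}_x,\mathbb{E}_x$ denote probability and expectation given $\Phi_0=x$. For nonnegative measurable $f$, $P^nf(x)=\int_X f(y)P^n(x,dy)$, and $P=P^1$. Irreducibility: $\Phi$ is $\psi$-irreducible, where $\psi$ is a maximal irreducibility measure: $\psi$ is a nontrivial $\sigma$-finite measure such that $\psi(A)>0$ implies that for every $x\in X$ there is $n\ge1$ with $P^n(x,A)>0$, and every other measure with this property is absolutely continuous with respect to $\psi$. The chain $\Phi$ is called strongly geometric transient if there exists a constant $\kappa>1$ such that $\sum_{n=1}^{\infty}\kappa^{n}P^{n}(x,X)<\infty$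 for all $x\in X$.
   Formalization: In (2) the constant κ>1 is taken independent of x (one κ works for all x∈X); with κ allowed to depend on x, as the wording literally says, (2) does not imply (1). *)

theory Defs
  imports "HOL-Probability.Probability"
begin

definition countably_generated :: "'a measure \<Rightarrow> bool" where
  "countably_generated M \<longleftrightarrow>
     (\<exists>G. countable G \<and> G \<subseteq> Pow (space M) \<and> sets M = sigma_sets (space M) G)"

(* The state space X (= space M) with one extra point None, the place of a chain that has left X. *)
definition cemetery_space :: "'a measure \<Rightarrow> 'a option measure" where
  "cemetery_space M = sigma (insert None (Some ` space M)) ((`) Some ` sets M)"

(* The probability, given the current position, that the next position lies in A (a subset of X).
   From None there is no return to X. *)
definition extended_kernel :: "('a \<Rightarrow> 'a measure) \<Rightarrow> 'a option \<Rightarrow> 'a set \<Rightarrow> ennreal" where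
  "extended_kernel P s A = (case s of None \<Rightarrow> 0 | Some y \<Rightarrow> emeasure (P y) A)"

(* The sigma-field generated by Phi_0, ..., Phi_n. *)
definition chain_history ::
    "'a measure \<Rightarrow> 'w measure \<Rightarrow> (nat \<Rightarrow> 'w \<Rightarrow> 'a option) \<Rightarrow> nat \<Rightarrow> 'w set set" where
  "chain_history M F \<Phi> n =
     sigma_sets (space F) {\<Phi> i -` B \<inter> space F | i B. i \<le> n \<and> B \<in> sets (cemetery_space M)}"

(* A time-homogeneous Markov chain Phi on X with (stochastic or sub-stochastic) transition
   kernel P, realised on the measurable space F; Pr x is the law started from x.  Every member
   of subprob_algebra M has total mass at most 1.  The initial condition says that Phi_0 has
   distribution delta_x; it is not stated as "Phi_0 = x almost surely" because points of X need
   not be measurable.  The last condition is the Markov property with respect to the natural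
   filtration; sets A inside X suffice, since the remaining mass is at None. *)
definition markov_chain ::
    "'a measure \<Rightarrow> ('a \<Rightarrow> 'a measure) \<Rightarrow> 'w measure \<Rightarrow> ('a \<Rightarrow> 'w measure) \<Rightarrow>
     (nat \<Rightarrow> 'w \<Rightarrow> 'a option) \<Rightarrow> bool" where
  "markov_chain M P F Pr \<Phi> \<longleftrightarrow>
     P \<in> M \<rightarrow>\<^sub>M subprob_algebra M \<and>
     (\<forall>n. \<Phi> n \<in> F \<rightarrow>\<^sub>M cemetery_space M) \<and>
     (\<forall>x\<in>space M.
        prob_space (Pr x) \<and> sets (Pr x) = sets F \<and>
        distr (Pr x) (cemetery_space M) (\<Phi> 0) = return (cemetery_space M) (Some x) \<and>
        (\<forall>n. \<forall>H\<in>chain_history M F \<Phi> n. \<forall>A\<in>sets M.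
           emeasure (Pr x) {\<omega>\<in>H. \<Phi> (Suc n) \<omega> \<in> Some ` A} =
           (\<integral>\<^sup>+\<omega>\<in>H. extended_kernel P (\<Phi> n \<omega>) A \<partial>Pr x)))"

definition transition_prob ::
    "('a \<Rightarrow> 'w measure) \<Rightarrow> (nat \<Rightarrow> 'w \<Rightarrow> 'a option) \<Rightarrow> nat \<Rightarrow> 'a \<Rightarrow> 'a set \<Rightarrow> ennreal" where
  "transition_prob Pr \<Phi> n x A = emeasure (Pr x) {\<omega>\<in>space (Pr x). \<Phi> n \<omega> \<in> Some ` A}"

definition irreducibility_measure ::
    "'a measure \<Rightarrow> ('a \<Rightarrow> 'w measure) \<Rightarrow> (nat \<Rightarrow> 'w \<Rightarrow> 'a option) \<Rightarrow> 'a measure \<Rightarrow> bool" where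
  "irreducibility_measure M Pr \<Phi> \<phi> \<longleftrightarrow>
     sets \<phi> = sets M \<and> sigma_finite_measure \<phi> \<and> emeasure \<phi> (space M) > 0 \<and>
     (\<forall>A\<in>sets M. emeasure \<phi> A > 0 \<longrightarrow>
        (\<forall>x\<in>space M. \<exists>n\<ge>1. transition_prob Pr \<Phi> n x A > 0))"

definition psi_irreducible ::
    "'a measure \<Rightarrow> ('a \<Rightarrow> 'w measure) \<Rightarrow> (nat \<Rightarrow> 'w \<Rightarrow> 'a option) \<Rightarrow> 'a measure \<Rightarrow> bool" where
  "psi_irreducible M Pr \<Phi> \<psi> \<longleftrightarrow>
     irreducibility_measure M Pr \<Phi> \<psi> \<and>
     (\<forall>\<phi>. irreducibility_measure M Pr \<Phi> \<phi> \<longrightarrow> absolutely_continuous \<psi> \<phi>)"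

definition last_time ::
    "'a measure \<Rightarrow> (nat \<Rightarrow> 'w \<Rightarrow> 'a option) \<Rightarrow> 'w \<Rightarrow> enat" where
  "last_time M \<Phi> \<omega> = (SUP n\<in>{n. \<Phi> n \<omega> \<in> Some ` space M}. enat n)"

(* kappa to the power t for kappa > 1, hence the value at infinity. *)
definition enat_power :: "real \<Rightarrow> enat \<Rightarrow> ennreal" where
  "enat_power \<kappa> t = (case t of enat n \<Rightarrow> ennreal (\<kappa> ^ n) | \<infinity> \<Rightarrow> \<infinity>)"

definition strongly_geometric_transient ::
    "'a measure \<Rightarrow> ('a \<Rightarrow> 'w measure) \<Rightarrow> (nat \<Rightarrow> 'w \<Rightarrow> 'a option) \<Rightarrow> bool" where
  "strongly_geometric_transient M Pr \<Phi> \<longleftrightarrow>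
     (\<exists>\<kappa>>1. \<forall>x\<in>space M.
        (\<Sum>n. ennreal (\<kappa> ^ Suc n) * transition_prob Pr \<Phi> (Suc n) x (space M)) < \<infinity>)"

definition kernel_apply :: "('a \<Rightarrow> 'a measure) \<Rightarrow> ('a \<Rightarrow> ennreal) \<Rightarrow> 'a \<Rightarrow> ennreal" where
  "kernel_apply P f x = (\<integral>\<^sup>+y. f y \<partial>P x)"

end

theory Submission
  imports Defs
begin

text \<open>
  Survival is almost surely decreasing in time, so \<open>\<kappa>\<^sup>\<tau>\<close> telescopes to
  \<open>1 + (1 - 1/\<kappa>) \<Sum> \<kappa>\<^sup>n 1{\<Phi>\<^sub>n \<in> X}\<close>, the sum being over \<open>n \<ge> 1\<close>; taking expectations gives the
  equivalence of (1) and (2).  For (3), \<open>W = \<Sum> \<kappa>\<^sup>n P\<^sup>n 1\<close>, the sum being over \<open>n \<ge> 0\<close>, satisfies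
  \<open>P W = (W - 1)/\<kappa>\<close>; conversely, iterating \<open>P W \<le> \<lambda> W\<close> yields \<open>P\<^sup>n 1 \<le> \<lambda>\<^sup>n W\<close>.
\<close>

section \<open>The state space with a cemetery point, and the pathwise identity for the last
  time\<close>

lemma space_cemetery_space: "space (cemetery_space M) = insert None (Some ` space M)"
  unfolding cemetery_space_def by (rule space_measure_of) (auto dest: sets.sets_into_space)

lemma Some_image_in_cemetery_space:
  assumes "A \<in> sets M"
  shows "Some ` A \<in> sets (cemetery_space M)"
proof -
  have "(`) Some ` sets M \<subseteq> Pow (insert None (Some ` space M))"
    by (auto dest: sets.sets_into_space)
  then have "sets (cemetery_space M) = sigma_sets (insert None (Some ` space M)) ((`) Some ` sets M)"
    unfolding cemetery_space_def by (rule sets_measure_of)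
  then show ?thesis
    using assms by auto
qed

lemma measurable_case_option_cemetery_space:
  fixes f :: "'a \<Rightarrow> 'b::topological_space"
  assumes [measurable]: "f \<in> borel_measurable M"
  shows "case_option c f \<in> borel_measurable (cemetery_space M)"
proof (rule borel_measurableI)
  fix S :: "'b set" assume "open S"
  then have [measurable]: "S \<in> sets borel" by simp
  have pre: "f -` S \<inter> space M \<in> sets M"
    by measurable
  show "case_option c f -` S \<inter> space (cemetery_space M) \<in> sets (cemetery_space M)"
  proof (cases "c \<in> S")
    case False
    then have "case_option c f -` S \<inter> space (cemetery_space M) = Some ` (f -` S \<inter> space M)"
      by (auto simp: space_cemetery_space)
    then show ?thesis
      using pre by (simp add: Some_image_in_cemetery_space)
  next
    case True
    then have "case_option c f -` S \<inter> space (cemetery_space M) =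
        space (cemetery_space M) - Some ` (space M - (f -` S \<inter> space M))"
      by (auto simp: space_cemetery_space)
    then show ?thesis
      using pre by (simp add: Some_image_in_cemetery_space sets.Diff)
  qed
qed

text \<open>For a fixed path, \<open>Q n\<close> stands for survival up to time \<open>n\<close>.
  Survival either never stops, and both sides are infinite, or it stops after a last time
  \<open>m\<close>, and a finite geometric sum collapses to \<kappa>^m - 1.\<close>

lemma enat_power_telescope:
  fixes \<kappa> :: real
  assumes \<kappa>: "\<kappa> > 1"
    and zero: "Q 0" and down: "\<And>n. Q (Suc n) \<Longrightarrow> Q n"
  shows "enat_power \<kappa> (SUP n\<in>{n. Q n}. enat n) =
    1 + ennreal (1 - 1 / \<kappa>) * (\<Sum>n. ennreal (\<kappa> ^ Suc n) * (if Q (Suc n) then 1 else 0))"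
proof -
  have down_le: "Q m" if "Q n" "m \<le> n" for m n
    using that(2,1) by (induction rule: inc_induct) (auto intro: down)
  define c where "c = 1 - 1 / \<kappa>"
  have c: "c > 0" using \<kappa> by (simp add: c_def)
  show ?thesis
  proof (cases "\<forall>n. Q n")
    \<comment> \<open>An unbounded set of survival times forces the supremum to be \<infinity>; on
      the right, a divergent geometric series is multiplied by the positive constant
      \<open>c\<close>.\<close>
    case True
    have inf: "(SUP n\<in>{n. Q n}. enat n) = \<infinity>"
    proof (rule ccontr)
      assume "(SUP n\<in>{n. Q n}. enat n) \<noteq> \<infinity>"
      then obtain m where m: "(SUP n\<in>{n. Q n}. enat n) = enat m" by auto
      have "enat (Suc m) \<le> (SUP n\<in>{n. Q n}. enat n)"
        using True by (intro SUP_upper) auto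
      then show False using m by simp
    qed
    have "(\<Sum>n. ennreal (\<kappa> ^ Suc n)) = \<top>"
    proof (rule ccontr)
      assume "(\<Sum>n. ennreal (\<kappa> ^ Suc n)) \<noteq> \<top>"
      then have "summable (\<lambda>n. \<kappa> ^ Suc n)"
        using \<kappa> by (intro summable_suminf_not_top) auto
      then have "summable (\<lambda>n. \<kappa> ^ n)"
        using summable_Suc_iff[of "\<lambda>n. \<kappa> ^ n"] by simp
      then show False
        using \<kappa> summable_geometric_iff[of \<kappa>] by simp
    qed
    then show ?thesis
      using True inf c
      by (simp add: enat_power_def c_def[symmetric] ennreal_mult_top)
  next
    case False
    \<comment> \<open>This \<open>m\<close> will be the last time at which \<open>Q\<close> holds.
      Since \<open>Q 0\<close> holds, any failure occurs at a successor, so looking only at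
      \<open>Suc n\<close> loses nothing and also covers \<open>m = 0\<close>.\<close>
    define m where "m = (LEAST n. \<not> Q (Suc n))"
    have ex: "\<exists>n. \<not> Q (Suc n)"
      using False zero by (metis not0_implies_Suc)
    have not_m: "\<not> Q (Suc m)"
      using ex unfolding m_def by (rule LeastI_ex)
    have "Q m"
    proof (cases m)
      case (Suc k)
      then have "k < (LEAST n. \<not> Q (Suc n))" by (simp add: m_def)
      then show ?thesis using not_less_Least Suc by blast
    qed (use zero in simp)
    then have Q_iff: "Q n \<longleftrightarrow> n \<le> m" for n
      using down_le not_m by (meson not_less_eq_eq)
    have sup: "(SUP n\<in>{n. Q n}. enat n) = enat m"
      by (rule antisym) (auto intro!: SUP_least SUP_upper simp: Q_iff)
    have "(\<Sum>n. ennreal (\<kappa> ^ Suc n) * (if Q (Suc n) then 1 else 0)) =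
        (\<Sum>n<m. ennreal (\<kappa> ^ Suc n))"
      by (subst suminf_finite[where N="{..<m}"]) (auto simp: Q_iff Suc_le_eq)
    also have "\<dots> = ennreal (\<Sum>n<m. \<kappa> ^ Suc n)"
      using \<kappa> by (intro sum_ennreal) auto
    finally have sum: "(\<Sum>n. ennreal (\<kappa> ^ Suc n) * (if Q (Suc n) then 1 else 0)) =
        ennreal (\<Sum>n<m. \<kappa> ^ Suc n)" .
    \<comment> \<open>The constant is chosen so that \<open>c * \<kappa> ^ Suc n\<close> is the
      increment of \<kappa>^n from \<open>n\<close> to \<open>Suc n\<close>, which makes the sum
      telescope.\<close>
    have "c * (\<Sum>n<m. \<kappa> ^ Suc n) = (\<Sum>n<m. \<kappa> ^ Suc n - \<kappa> ^ n)"
      unfolding sum_distrib_left using \<kappa> by (intro sum.cong) (auto simp: c_def field_simps)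
    also have "\<dots> = \<kappa> ^ m - 1"
      by (simp only: sum_lessThan_telescope) simp
    finally have "\<kappa> ^ m = 1 + c * (\<Sum>n<m. \<kappa> ^ Suc n)" by simp
    moreover have "0 \<le> (\<Sum>n<m. \<kappa> ^ Suc n)"
      using \<kappa> by (intro sum_nonneg) auto
    ultimately show ?thesis
      using c by (simp add: sup sum enat_power_def c_def[symmetric] ennreal_mult ennreal_plus
          del: power_Suc)
  qed
qed

section \<open>Expectations along the chain as powers of the kernel\<close>

locale markov =
  fixes M :: "'a measure" and P :: "'a \<Rightarrow> 'a measure"
    and F :: "'w measure" and Pr :: "'a \<Rightarrow> 'w measure"
    and \<Phi> :: "nat \<Rightarrow> 'w \<Rightarrow> 'a option"
  assumes chain: "markov_chain M P F Pr \<Phi>"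
begin

lemma kernel [measurable]: "P \<in> M \<rightarrow>\<^sub>M subprob_algebra M"
  and \<Phi>_measurable [measurable]: "\<Phi> n \<in> F \<rightarrow>\<^sub>M cemetery_space M"
  using chain by (auto simp: markov_chain_def)

lemma
  assumes "x \<in> space M"
  shows prob_space_Pr: "prob_space (Pr x)"
    and sets_Pr [measurable_cong]: "sets (Pr x) = sets F"
    and distr_\<Phi>_0: "distr (Pr x) (cemetery_space M) (\<Phi> 0) = return (cemetery_space M) (Some x)"
    and markov_property: "\<And>n H A. H \<in> chain_history M F \<Phi> n \<Longrightarrow> A \<in> sets M \<Longrightarrow>
      emeasure (Pr x) {\<omega>\<in>H. \<Phi> (Suc n) \<omega> \<in> Some ` A} =
      (\<integral>\<^sup>+\<omega>\<in>H. extended_kernel P (\<Phi> n \<omega>) A \<partial>Pr x)"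
  using chain assms by (auto simp: markov_chain_def)

lemma space_Pr: "x \<in> space M \<Longrightarrow> space (Pr x) = space F"
  by (rule sets_eq_imp_space_eq) (rule sets_Pr)

lemma \<Phi>_cases:
  assumes "\<omega> \<in> space F"
  obtains "\<Phi> n \<omega> = None" | y where "y \<in> space M" "\<Phi> n \<omega> = Some y"
  using measurable_space[OF \<Phi>_measurable[of n] assms] by (auto simp: space_cemetery_space)

lemma \<Phi>_in_sets:
  assumes "A \<in> sets M"
  shows "{\<omega> \<in> space F. \<Phi> n \<omega> \<in> Some ` A} \<in> sets F"
proof -
  have "\<Phi> n -` Some ` A \<inter> space F \<in> sets F"
    using assms by (intro measurable_sets[OF \<Phi>_measurable] Some_image_in_cemetery_space)
  moreover have "\<Phi> n -` Some ` A \<inter> space F = {\<omega> \<in> space F. \<Phi> n \<omega> \<in> Some ` A}" by auto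
  ultimately show ?thesis by simp
qed

lemma sets_P: "y \<in> space M \<Longrightarrow> sets (P y) = sets M"
  using measurable_space[OF kernel] by (auto simp: space_subprob_algebra)

lemma space_P: "y \<in> space M \<Longrightarrow> space (P y) = space M"
  by (rule sets_eq_imp_space_eq) (rule sets_P)

lemma borel_measurable_P:
  "y \<in> space M \<Longrightarrow> f \<in> borel_measurable M \<Longrightarrow> f \<in> borel_measurable (P y)"
  using measurable_cong_sets[OF sets_P refl] by blast

lemma kernel_apply_measurable [measurable]:
  "f \<in> borel_measurable M \<Longrightarrow> kernel_apply P f \<in> borel_measurable M"
  unfolding kernel_apply_def
  by (rule measurable_compose[OF kernel nn_integral_measurable_subprob_algebra])

lemma kernel_apply_mono:
  assumes "y \<in> space M" "\<And>z. z \<in> space M \<Longrightarrow> f z \<le> g z"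
  shows "kernel_apply P f y \<le> kernel_apply P g y"
  unfolding kernel_apply_def using assms by (intro nn_integral_mono) (auto simp: space_P)

lemma kernel_apply_cong:
  assumes "y \<in> space M" "\<And>z. z \<in> space M \<Longrightarrow> f z = g z"
  shows "kernel_apply P f y = kernel_apply P g y"
  unfolding kernel_apply_def using assms by (intro nn_integral_cong) (auto simp: space_P)

text \<open>Functions on the state space are extended by 0 at \<open>None\<close>, so expectations
  of them count only the paths that have not yet escaped.\<close>

lemma observable_measurable:
  fixes f :: "'a \<Rightarrow> ennreal"
  assumes "x \<in> space M" "f \<in> borel_measurable M"
  shows "(\<lambda>\<omega>. case_option 0 f (\<Phi> n \<omega>)) \<in> borel_measurable (Pr x)"
proof -
  have "(\<lambda>\<omega>. case_option 0 f (\<Phi> n \<omega>)) \<in> borel_measurable F"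
    by (rule measurable_compose[OF \<Phi>_measurable measurable_case_option_cemetery_space[OF assms(2)]])
  then show ?thesis
    using measurable_cong_sets[OF sets_Pr[OF assms(1)] refl] by blast
qed

lemma space_in_chain_history: "space F \<in> chain_history M F \<Phi> n"
  unfolding chain_history_def by (rule sigma_sets_top)

text \<open>The Markov property speaks of sets only. It passes to nonnegative measurable functions
  by the usual induction over indicators, multiples, sums and increasing limits, since both sides
  respect these operations.\<close>

lemma expectation_Suc:
  assumes x: "x \<in> space M" and f: "f \<in> borel_measurable M"
  shows "(\<integral>\<^sup>+\<omega>. case_option 0 f (\<Phi> (Suc n) \<omega>) \<partial>Pr x) =
    (\<integral>\<^sup>+\<omega>. case_option 0 (kernel_apply P f) (\<Phi> n \<omega>) \<partial>Pr x)"
  using f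
proof (induction rule: borel_measurable_induct)
  \<comment> \<open>The two functions agree only on \<open>space M\<close>. This suffices, because
    each \<open>\<Phi> n \<omega>\<close> is \<open>None\<close> or a point of
    \<open>space M\<close>, and each \<open>P y\<close> lives on \<open>space M\<close>.\<close>
  case (cong f g)
  have "(\<integral>\<^sup>+\<omega>. case_option 0 f (\<Phi> (Suc n) \<omega>) \<partial>Pr x) = (\<integral>\<^sup>+\<omega>. case_option 0 g (\<Phi> (Suc n) \<omega>) \<partial>Pr x)"
    by (intro nn_integral_cong)
      (auto simp: space_Pr[OF x] cong.hyps elim: \<Phi>_cases[where n="Suc n"] split: option.split)
  moreover have "(\<integral>\<^sup>+\<omega>. case_option 0 (kernel_apply P f) (\<Phi> n \<omega>) \<partial>Pr x) =
      (\<integral>\<^sup>+\<omega>. case_option 0 (kernel_apply P g) (\<Phi> n \<omega>) \<partial>Pr x)"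
  proof (rule nn_integral_cong)
    fix \<omega> assume "\<omega> \<in> space (Pr x)"
    then have "\<omega> \<in> space F" by (simp add: space_Pr[OF x])
    then show "case_option 0 (kernel_apply P f) (\<Phi> n \<omega>) = case_option 0 (kernel_apply P g) (\<Phi> n \<omega>)"
      by (cases rule: \<Phi>_cases[where n=n]) (auto intro!: kernel_apply_cong cong.hyps)
  qed
  ultimately show ?case using cong.IH by simp
next
  case (set A)
  have "(\<integral>\<^sup>+\<omega>. case_option 0 (indicator A) (\<Phi> (Suc n) \<omega>) \<partial>Pr x) =
      (\<integral>\<^sup>+\<omega>. indicator {\<omega>\<in>space F. \<Phi> (Suc n) \<omega> \<in> Some ` A} \<omega> \<partial>Pr x)"
    by (intro nn_integral_cong) (auto simp: space_Pr[OF x] indicator_def split: option.split)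
  also have "\<dots> = emeasure (Pr x) {\<omega>\<in>space F. \<Phi> (Suc n) \<omega> \<in> Some ` A}"
    using \<Phi>_in_sets[OF set] by (intro nn_integral_indicator) (simp add: sets_Pr[OF x])
  \<comment> \<open>The whole sample space belongs to every history, so taking it as the past event
    gives the unconditional one-step formula.\<close>
  also have "\<dots> = (\<integral>\<^sup>+\<omega>\<in>space F. extended_kernel P (\<Phi> n \<omega>) A \<partial>Pr x)"
    using x space_in_chain_history set by (rule markov_property)
  also have "\<dots> = (\<integral>\<^sup>+\<omega>. case_option 0 (kernel_apply P (indicator A)) (\<Phi> n \<omega>) \<partial>Pr x)"
  proof (rule nn_integral_cong)
    fix \<omega> assume "\<omega> \<in> space (Pr x)"
    then have \<omega>: "\<omega> \<in> space F" by (simp add: space_Pr[OF x])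
    then show "extended_kernel P (\<Phi> n \<omega>) A * indicator (space F) \<omega> =
        case_option 0 (kernel_apply P (indicator A)) (\<Phi> n \<omega>)"
      using set
      by (cases rule: \<Phi>_cases[where n=n]) (auto simp: \<omega> extended_kernel_def kernel_apply_def sets_P)
  qed
  finally show ?case .
next
  case (mult u c)
  note [measurable] = mult.hyps(2)
  have "(\<integral>\<^sup>+\<omega>. case_option 0 (\<lambda>z. c * u z) (\<Phi> (Suc n) \<omega>) \<partial>Pr x) =
      (\<integral>\<^sup>+\<omega>. c * case_option 0 u (\<Phi> (Suc n) \<omega>) \<partial>Pr x)"
    by (intro nn_integral_cong) (auto split: option.split)
  also have "\<dots> = c * (\<integral>\<^sup>+\<omega>. case_option 0 u (\<Phi> (Suc n) \<omega>) \<partial>Pr x)"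
    by (intro nn_integral_cmult observable_measurable x) measurable
  also have "\<dots> = (\<integral>\<^sup>+\<omega>. c * case_option 0 (kernel_apply P u) (\<Phi> n \<omega>) \<partial>Pr x)"
    unfolding mult.IH
    by (intro nn_integral_cmult[symmetric] observable_measurable x) measurable
  also have "\<dots> = (\<integral>\<^sup>+\<omega>. case_option 0 (kernel_apply P (\<lambda>z. c * u z)) (\<Phi> n \<omega>) \<partial>Pr x)"
  proof (rule nn_integral_cong)
    fix \<omega> assume "\<omega> \<in> space (Pr x)"
    then have "\<omega> \<in> space F" by (simp add: space_Pr[OF x])
    then show "c * case_option 0 (kernel_apply P u) (\<Phi> n \<omega>) =
        case_option 0 (kernel_apply P (\<lambda>z. c * u z)) (\<Phi> n \<omega>)"
      by (cases rule: \<Phi>_cases[where n=n])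
        (auto simp: kernel_apply_def nn_integral_cmult borel_measurable_P)
  qed
  finally show ?case .
next
  case (add u v)
  note [measurable] = add.hyps
  have "(\<integral>\<^sup>+\<omega>. case_option 0 (\<lambda>z. v z + u z) (\<Phi> (Suc n) \<omega>) \<partial>Pr x) =
      (\<integral>\<^sup>+\<omega>. case_option 0 v (\<Phi> (Suc n) \<omega>) + case_option 0 u (\<Phi> (Suc n) \<omega>) \<partial>Pr x)"
    by (intro nn_integral_cong) (auto split: option.split)
  also have "\<dots> = (\<integral>\<^sup>+\<omega>. case_option 0 v (\<Phi> (Suc n) \<omega>) \<partial>Pr x) +
      (\<integral>\<^sup>+\<omega>. case_option 0 u (\<Phi> (Suc n) \<omega>) \<partial>Pr x)"
    by (intro nn_integral_add observable_measurable x) measurable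
  also have "\<dots> = (\<integral>\<^sup>+\<omega>. case_option 0 (kernel_apply P v) (\<Phi> n \<omega>) +
      case_option 0 (kernel_apply P u) (\<Phi> n \<omega>) \<partial>Pr x)"
    unfolding add.IH
    by (intro nn_integral_add[symmetric] observable_measurable x) measurable
  also have "\<dots> = (\<integral>\<^sup>+\<omega>. case_option 0 (kernel_apply P (\<lambda>z. v z + u z)) (\<Phi> n \<omega>) \<partial>Pr x)"
  proof (rule nn_integral_cong)
    fix \<omega> assume "\<omega> \<in> space (Pr x)"
    then have "\<omega> \<in> space F" by (simp add: space_Pr[OF x])
    then show "case_option 0 (kernel_apply P v) (\<Phi> n \<omega>) + case_option 0 (kernel_apply P u) (\<Phi> n \<omega>) =
        case_option 0 (kernel_apply P (\<lambda>z. v z + u z)) (\<Phi> n \<omega>)"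
      by (cases rule: \<Phi>_cases[where n=n])
        (auto simp: kernel_apply_def nn_integral_add borel_measurable_P)
  qed
  finally show ?case .
next
  case (seq U)
  note [measurable] = seq.hyps(1)
  have mono: "U i z \<le> U (Suc i) z" for i z
    using \<open>incseq U\<close> by (auto simp: incseq_Suc_iff le_fun_def)
  have "(\<integral>\<^sup>+\<omega>. case_option 0 (SUP i. U i) (\<Phi> (Suc n) \<omega>) \<partial>Pr x) =
      (\<integral>\<^sup>+\<omega>. (SUP i. case_option 0 (U i) (\<Phi> (Suc n) \<omega>)) \<partial>Pr x)"
    by (intro nn_integral_cong) (auto split: option.split simp: image_comp)
  also have "\<dots> = (SUP i. \<integral>\<^sup>+\<omega>. case_option 0 (U i) (\<Phi> (Suc n) \<omega>) \<partial>Pr x)"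
    by (intro nn_integral_monotone_convergence_SUP observable_measurable x)
      (auto simp: incseq_Suc_iff le_fun_def mono split: option.split)
  also have "\<dots> = (SUP i. \<integral>\<^sup>+\<omega>. case_option 0 (kernel_apply P (U i)) (\<Phi> n \<omega>) \<partial>Pr x)"
    by (simp add: seq.IH)
  also have "\<dots> = (\<integral>\<^sup>+\<omega>. (SUP i. case_option 0 (kernel_apply P (U i)) (\<Phi> n \<omega>)) \<partial>Pr x)"
    by (intro nn_integral_monotone_convergence_SUP[symmetric] observable_measurable x)
      (auto simp: incseq_Suc_iff le_fun_def kernel_apply_def
        intro!: nn_integral_mono mono kernel_apply_measurable split: option.split)
  also have "\<dots> = (\<integral>\<^sup>+\<omega>. case_option 0 (kernel_apply P (SUP i. U i)) (\<Phi> n \<omega>) \<partial>Pr x)"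
  proof (rule nn_integral_cong)
    fix \<omega> assume "\<omega> \<in> space (Pr x)"
    then have "\<omega> \<in> space F" by (simp add: space_Pr[OF x])
    then show "(SUP i. case_option 0 (kernel_apply P (U i)) (\<Phi> n \<omega>)) =
        case_option 0 (kernel_apply P (SUP i. U i)) (\<Phi> n \<omega>)"
    proof (cases rule: \<Phi>_cases[where n=n])
      case (2 y)
      \<comment> \<open>Monotone convergence is used a second time, now under the kernel at a fixed
        state instead of under the law of the path.\<close>
      have "(\<integral>\<^sup>+z. (SUP i. U i z) \<partial>P y) = (SUP i. \<integral>\<^sup>+z. U i z \<partial>P y)"
        using \<open>y \<in> space M\<close> seq.hyps
        by (intro nn_integral_monotone_convergence_SUP) (auto intro: borel_measurable_P)
      then show ?thesis
        using 2 by (simp add: kernel_apply_def image_comp)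
    qed simp
  qed
  finally show ?case .
qed

text \<open>The initial condition fixes the distribution of \<open>\<Phi> 0\<close> only, so the
  integral is first transported to the space of states, where it is an integral against a point
  mass.\<close>

lemma expectation_0:
  assumes x: "x \<in> space M" and f: "f \<in> borel_measurable M"
  shows "(\<integral>\<^sup>+\<omega>. case_option 0 f (\<Phi> 0 \<omega>) \<partial>Pr x) = f x"
proof -
  have m: "case_option 0 f \<in> borel_measurable (cemetery_space M)"
    by (rule measurable_case_option_cemetery_space[OF f])
  have "\<Phi> 0 \<in> Pr x \<rightarrow>\<^sub>M cemetery_space M"
    using measurable_cong_sets[OF sets_Pr[OF x] refl] \<Phi>_measurable by blast
  then have "(\<integral>\<^sup>+\<omega>. case_option 0 f (\<Phi> 0 \<omega>) \<partial>Pr x) =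
      (\<integral>\<^sup>+s. case_option 0 f s \<partial>distr (Pr x) (cemetery_space M) (\<Phi> 0))"
    using m by (simp add: nn_integral_distr)
  also have "\<dots> = f x"
    using m x by (simp add: distr_\<Phi>_0 nn_integral_return space_cemetery_space)
  finally show ?thesis .
qed

text \<open>Each step back in time replaces \<open>f\<close> by \<open>kernel_apply P f\<close>. The
  new factor stands innermost in the power, hence the induction with \<open>f\<close> arbitrary and
  the use of \<open>funpow_Suc_right\<close>.\<close>

lemma expectation_eq_kernel_power:
  assumes "x \<in> space M" "f \<in> borel_measurable M"
  shows "(\<integral>\<^sup>+\<omega>. case_option 0 f (\<Phi> n \<omega>) \<partial>Pr x) = (kernel_apply P ^^ n) f x"
  using assms(2)
proof (induction n arbitrary: f)
  case 0
  then show ?case using assms(1) by (simp add: expectation_0)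
next
  case (Suc n)
  then show ?case
    using assms(1) by (simp add: expectation_Suc funpow_Suc_right del: funpow.simps)
qed

lemma kernel_power_measurable [measurable]:
  "f \<in> borel_measurable M \<Longrightarrow> (kernel_apply P ^^ n) f \<in> borel_measurable M"
  by (induction n) auto

text \<open>Survival at time \<open>n\<close> is the observable that is 1 on the state space and 0
  at \<open>None\<close>.\<close>

lemma transition_prob_eq_kernel_power:
  assumes x: "x \<in> space M"
  shows "transition_prob Pr \<Phi> n x (space M) = (kernel_apply P ^^ n) (\<lambda>_. 1) x"
proof -
  have "(kernel_apply P ^^ n) (\<lambda>_. 1) x = (\<integral>\<^sup>+\<omega>. case_option 0 (\<lambda>_. 1) (\<Phi> n \<omega>) \<partial>Pr x)"
    using x by (simp add: expectation_eq_kernel_power)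
  also have "\<dots> = (\<integral>\<^sup>+\<omega>. indicator {\<omega>\<in>space F. \<Phi> n \<omega> \<in> Some ` space M} \<omega> \<partial>Pr x)"
    by (intro nn_integral_cong)
      (auto simp: space_Pr[OF x] indicator_def elim: \<Phi>_cases[where n=n] split: option.split)
  also have "\<dots> = emeasure (Pr x) {\<omega>\<in>space F. \<Phi> n \<omega> \<in> Some ` space M}"
    using \<Phi>_in_sets[OF sets.top] by (intro nn_integral_indicator) (simp add: sets_Pr[OF x])
  finally show ?thesis
    by (simp add: transition_prob_def space_Pr[OF x])
qed

section \<open>Almost sure monotonicity of survival and exponential moments of the last time\<close>

lemma AE_start:
  assumes x: "x \<in> space M"
  shows "AE \<omega> in Pr x. \<Phi> 0 \<omega> \<in> Some ` space M"
proof -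
  interpret prob_space "Pr x" using x by (rule prob_space_Pr)
  \<comment> \<open>The zeroth power of the kernel leaves the constant function 1 unchanged.\<close>
  have "emeasure (Pr x) {\<omega>\<in>space (Pr x). \<Phi> 0 \<omega> \<in> Some ` space M} = 1"
    using transition_prob_eq_kernel_power[OF x, of 0] by (simp add: transition_prob_def)
  moreover have "{\<omega>\<in>space (Pr x). \<Phi> 0 \<omega> \<in> Some ` space M} \<in> sets (Pr x)"
    using \<Phi>_in_sets[OF sets.top] by (simp add: sets_Pr[OF x] space_Pr[OF x])
  ultimately show ?thesis
    by (simp add: AE_iff_emeasure_eq_1)
qed

text \<open>Absence of return is encoded in \<open>extended_kernel\<close>, which vanishes at
  \<open>None\<close>. The Markov property with the past event that the chain is at
  \<open>None\<close> at time \<open>n\<close> therefore makes a return at the next step a null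
  event.\<close>

lemma AE_no_return:
  assumes x: "x \<in> space M"
  shows "AE \<omega> in Pr x. \<Phi> (Suc n) \<omega> \<in> Some ` space M \<longrightarrow> \<Phi> n \<omega> \<in> Some ` space M"
proof -
  \<comment> \<open>The event \<open>\<Phi> n \<omega> = None\<close>, written as the preimage of a
    complement so that it is visibly an event of the history up to time \<open>n\<close>.\<close>
  define H where "H = \<Phi> n -` (space (cemetery_space M) - Some ` space M) \<inter> space F"
  have H: "\<Phi> n \<omega> = None" if "\<omega> \<in> H" for \<omega>
    using that by (auto simp: H_def space_cemetery_space)
  have "H \<in> chain_history M F \<Phi> n"
    unfolding chain_history_def H_def
    by (intro sigma_sets.Basic)
      (blast intro: sets.Diff sets.top Some_image_in_cemetery_space)
  then have "emeasure (Pr x) {\<omega>\<in>H. \<Phi> (Suc n) \<omega> \<in> Some ` space M} =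
      (\<integral>\<^sup>+\<omega>\<in>H. extended_kernel P (\<Phi> n \<omega>) (space M) \<partial>Pr x)"
    using x by (intro markov_property) auto
  also have "\<dots> = (\<integral>\<^sup>+\<omega>. 0 \<partial>Pr x)"
    by (intro nn_integral_cong) (auto simp: H extended_kernel_def indicator_def)
  finally have null: "emeasure (Pr x) {\<omega>\<in>H. \<Phi> (Suc n) \<omega> \<in> Some ` space M} = 0" by simp
  have "H \<in> sets F"
    unfolding H_def
    by (intro measurable_sets[OF \<Phi>_measurable] sets.Diff sets.top Some_image_in_cemetery_space)
  then have "H \<inter> {\<omega>\<in>space F. \<Phi> (Suc n) \<omega> \<in> Some ` space M} \<in> sets F"
    by (intro sets.Int \<Phi>_in_sets) auto
  moreover have "H \<inter> {\<omega>\<in>space F. \<Phi> (Suc n) \<omega> \<in> Some ` space M} =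
      {\<omega>\<in>H. \<Phi> (Suc n) \<omega> \<in> Some ` space M}"
    by (auto simp: H_def)
  ultimately have "{\<omega>\<in>H. \<Phi> (Suc n) \<omega> \<in> Some ` space M} \<in> null_sets (Pr x)"
    using null by (simp add: null_sets_def sets_Pr[OF x])
  then show ?thesis
  proof (rule AE_I')
    show "{\<omega>\<in>space (Pr x). \<not> (\<Phi> (Suc n) \<omega> \<in> Some ` space M \<longrightarrow> \<Phi> n \<omega> \<in> Some ` space M)}
        \<subseteq> {\<omega>\<in>H. \<Phi> (Suc n) \<omega> \<in> Some ` space M}"
      using measurable_space[OF \<Phi>_measurable[of n]] by (auto simp: H_def space_Pr[OF x])
  qed
qed

text \<open>The telescoped identity holds on almost every path, as only countably many null events
  of return and a bad start are discarded. Sum and integral then commute because all terms are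
  nonnegative.\<close>

lemma expectation_enat_power_last_time:
  assumes x: "x \<in> space M" and \<kappa>: "\<kappa> > 1"
  shows "(\<integral>\<^sup>+\<omega>. enat_power \<kappa> (last_time M \<Phi> \<omega>) \<partial>Pr x) =
    1 + ennreal (1 - 1 / \<kappa>) *
      (\<Sum>n. ennreal (\<kappa> ^ Suc n) * transition_prob Pr \<Phi> (Suc n) x (space M))"
proof -
  interpret prob_space "Pr x" using x by (rule prob_space_Pr)
  define I :: "nat \<Rightarrow> 'w \<Rightarrow> ennreal"
    where "I n \<omega> = (if \<Phi> n \<omega> \<in> Some ` space M then 1 else 0)" for n \<omega>
  have meas: "{\<omega>\<in>space (Pr x). \<Phi> n \<omega> \<in> Some ` space M} \<in> sets (Pr x)" for n
    using \<Phi>_in_sets[OF sets.top] by (simp add: sets_Pr[OF x] space_Pr[OF x])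
  have I_measurable [measurable]: "I n \<in> borel_measurable (Pr x)" for n
    unfolding I_def using meas by (intro measurable_If) auto
  have "(\<integral>\<^sup>+\<omega>. I n \<omega> \<partial>Pr x) =
      (\<integral>\<^sup>+\<omega>. indicator {\<omega>\<in>space (Pr x). \<Phi> n \<omega> \<in> Some ` space M} \<omega> \<partial>Pr x)" for n
    by (intro nn_integral_cong) (auto simp: I_def indicator_def)
  then have I_integral: "(\<integral>\<^sup>+\<omega>. I n \<omega> \<partial>Pr x) = transition_prob Pr \<Phi> n x (space M)" for n
    using meas by (simp add: transition_prob_def)
  have "AE \<omega> in Pr x. \<forall>n. \<Phi> (Suc n) \<omega> \<in> Some ` space M \<longrightarrow> \<Phi> n \<omega> \<in> Some ` space M"
    unfolding AE_all_countable using AE_no_return[OF x] by blast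
  then have "AE \<omega> in Pr x. enat_power \<kappa> (last_time M \<Phi> \<omega>) =
      1 + ennreal (1 - 1 / \<kappa>) * (\<Sum>n. ennreal (\<kappa> ^ Suc n) * I (Suc n) \<omega>)"
    using AE_start[OF x]
  proof eventually_elim
    case (elim \<omega>)
    then show ?case
      unfolding last_time_def I_def by (intro enat_power_telescope \<kappa>) auto
  qed
  then have "(\<integral>\<^sup>+\<omega>. enat_power \<kappa> (last_time M \<Phi> \<omega>) \<partial>Pr x) =
      (\<integral>\<^sup>+\<omega>. 1 + ennreal (1 - 1 / \<kappa>) * (\<Sum>n. ennreal (\<kappa> ^ Suc n) * I (Suc n) \<omega>) \<partial>Pr x)"
    by (rule nn_integral_cong_AE)
  also have "\<dots> = 1 + ennreal (1 - 1 / \<kappa>) * (\<Sum>n. ennreal (\<kappa> ^ Suc n) * (\<integral>\<^sup>+\<omega>. I (Suc n) \<omega> \<partial>Pr x))"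
    by (simp add: nn_integral_add nn_integral_cmult nn_integral_suminf emeasure_space_1
        del: power_Suc)
  finally show ?thesis by (simp only: I_integral)
qed

text \<open>The same \<kappa> serves on both sides: the series and the expectation differ by adding
  1 and by the factor 1 - 1/\<kappa>, which is positive and finite.\<close>

lemma strongly_geometric_transient_iff:
  "strongly_geometric_transient M Pr \<Phi> \<longleftrightarrow>
    (\<exists>\<kappa>>1. \<forall>x\<in>space M. (\<integral>\<^sup>+\<omega>. enat_power \<kappa> (last_time M \<Phi> \<omega>) \<partial>Pr x) < \<infinity>)"
  unfolding strongly_geometric_transient_def
proof (intro ex_cong1 conj_cong refl ball_cong)
  fix \<kappa> :: real and x assume "1 < \<kappa>" "x \<in> space M"
  then show "(\<Sum>n. ennreal (\<kappa> ^ Suc n) * transition_prob Pr \<Phi> (Suc n) x (space M)) < \<infinity> \<longleftrightarrow>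
      (\<integral>\<^sup>+\<omega>. enat_power \<kappa> (last_time M \<Phi> \<omega>) \<partial>Pr x) < \<infinity>"
    by (auto simp: expectation_enat_power_last_time ennreal_mult_less_top simp del: power_Suc)
qed

section \<open>Equivalence with the drift condition\<close>

lemma drift_function_exists:
  assumes "strongly_geometric_transient M Pr \<Phi>"
  obtains r :: real and W :: "'a \<Rightarrow> real"
  where "0 < r" "r < 1" "W \<in> borel_measurable M" "\<And>x. x \<in> space M \<Longrightarrow> 1 \<le> W x"
    "\<And>x. x \<in> space M \<Longrightarrow> kernel_apply P (\<lambda>y. ennreal (W y)) x \<le> ennreal (r * W x)"
proof -
  define u where "u n = (kernel_apply P ^^ n) (\<lambda>_. 1)" for n
  have u_measurable [measurable]: "u n \<in> borel_measurable M" for n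
    unfolding u_def by measurable
  have u_Suc: "u (Suc n) x = (\<integral>\<^sup>+y. u n y \<partial>P x)" for n x
    by (simp add: u_def kernel_apply_def)
  obtain \<kappa> where \<kappa>: "\<kappa> > 1"
    and fin: "\<And>x. x \<in> space M \<Longrightarrow> (\<Sum>n. ennreal (\<kappa> ^ Suc n) * u (Suc n) x) < \<infinity>"
    using assms unfolding strongly_geometric_transient_def u_def
    by (auto simp: transition_prob_eq_kernel_power simp del: power_Suc funpow.simps)
  \<comment> \<open>The candidate is built with values in \<open>ennreal\<close>, where series and
    kernel commute freely; finiteness comes afterwards.\<close>
  define V where "V x = (\<Sum>n. ennreal (\<kappa> ^ n) * u n x)" for x
  have V_measurable [measurable]: "V \<in> borel_measurable M"
    unfolding V_def by measurable
  \<comment> \<open>Splitting off the term at \<open>n = 0\<close>, which is 1, gives the lower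
    bound for \<open>V\<close> and leaves exactly the series assumed to be finite.\<close>
  have V_split: "V x = 1 + (\<Sum>n. ennreal (\<kappa> ^ Suc n) * u (Suc n) x)" for x
    unfolding V_def
    using suminf_offset[OF summableI, of "\<lambda>n. ennreal (\<kappa> ^ n) * u n x" 1]
    by (simp add: u_def del: power_Suc)
  have V_fin: "V x < \<top>" if "x \<in> space M" for x
    using fin[OF that] by (simp add: V_split del: power_Suc)
  \<comment> \<open>Applying the kernel raises each power by one, and the factor \<kappa> restores
    the matching weights: the result is \<open>V\<close> without its initial term.\<close>
  have PV: "ennreal \<kappa> * kernel_apply P V x \<le> V x" if x: "x \<in> space M" for x
  proof -
    have "kernel_apply P V x = (\<Sum>n. ennreal (\<kappa> ^ n) * u (Suc n) x)"
      using x unfolding V_def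
      by (simp add: kernel_apply_def nn_integral_suminf nn_integral_cmult borel_measurable_P u_Suc)
    then have "ennreal \<kappa> * kernel_apply P V x = (\<Sum>n. ennreal (\<kappa> ^ Suc n) * u (Suc n) x)"
      using \<kappa> by (simp add: ennreal_mult mult.assoc)
    then show ?thesis by (simp add: V_split)
  qed
  \<comment> \<open>Finiteness of \<open>V\<close> on \<open>space M\<close> makes this real version
    lossless there.\<close>
  define W where "W x = enn2real (V x)" for x
  have W: "ennreal (W x) = V x" if "x \<in> space M" for x
    using V_fin[OF that] by (simp add: W_def)
  show ?thesis
  proof
    show "0 < 1 / \<kappa>" "1 / \<kappa> < 1" using \<kappa> by auto
    show "W \<in> borel_measurable M" unfolding W_def by measurable
    fix x assume x: "x \<in> space M"
    have "1 \<le> ennreal (W x)" using x by (simp add: W V_split)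
    then show "1 \<le> W x" by simp
    have "kernel_apply P (\<lambda>y. ennreal (W y)) x = kernel_apply P V x"
      using x by (intro kernel_apply_cong) (auto simp: W)
    also have "\<dots> = ennreal (1 / \<kappa>) * (ennreal \<kappa> * kernel_apply P V x)"
      using \<kappa> by (simp add: mult.assoc[symmetric] ennreal_mult[symmetric])
    also have "\<dots> \<le> ennreal (1 / \<kappa>) * ennreal (W x)"
      using PV[OF x] x by (intro mult_left_mono) (auto simp: W)
    also have "\<dots> = ennreal (1 / \<kappa> * W x)"
      using \<kappa> by (intro ennreal_mult[symmetric]) (auto simp: W_def)
    finally show "kernel_apply P (\<lambda>y. ennreal (W y)) x \<le> ennreal (1 / \<kappa> * W x)" .
  qed
qed

text \<open>As 1 lies below \<open>W\<close>, iterating the drift bounds the survival probabilities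
  by \<open>r ^ n * W x\<close>. Any \<kappa> strictly between 1 and 1/r then leaves a convergent
  geometric series.\<close>

lemma drift_imp_strongly_geometric_transient:
  fixes r :: real and W :: "'a \<Rightarrow> real"
  assumes r: "0 < r" "r < 1"
    and W_measurable [measurable]: "W \<in> borel_measurable M"
    and W_ge: "\<And>x. x \<in> space M \<Longrightarrow> 1 \<le> W x"
    and drift: "\<And>x. x \<in> space M \<Longrightarrow> kernel_apply P (\<lambda>y. ennreal (W y)) x \<le> ennreal (r * W x)"
  shows "strongly_geometric_transient M Pr \<Phi>"
proof -
  have bound: "(kernel_apply P ^^ n) (\<lambda>_. 1) x \<le> ennreal (r ^ n * W x)" if "x \<in> space M" for n x
    using that
  proof (induction n arbitrary: x)
    case 0
    then show ?case using W_ge by simp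
  next
    case (Suc n)
    \<comment> \<open>The induction hypothesis is applied at every state under the outermost kernel,
      and the drift inequality is then used once at \<open>x\<close>.\<close>
    have "(kernel_apply P ^^ Suc n) (\<lambda>_. 1) x \<le> kernel_apply P (\<lambda>y. ennreal (r ^ n * W y)) x"
      using Suc by (simp add: kernel_apply_mono)
    also have "\<dots> = ennreal (r ^ n) * kernel_apply P (\<lambda>y. ennreal (W y)) x"
      using Suc.prems r unfolding kernel_apply_def
      by (simp add: ennreal_mult' nn_integral_cmult borel_measurable_P)
    also have "\<dots> \<le> ennreal (r ^ n) * ennreal (r * W x)"
      by (intro mult_left_mono drift Suc.prems) simp
    also have "\<dots> = ennreal (r ^ Suc n * W x)"
      using r by (simp add: ennreal_mult'[symmetric] mult_ac)
    finally show ?case .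
  qed
  \<comment> \<open>The midpoint of 1 and 1/r: it exceeds 1, and its product with \<open>r\<close>
    is the midpoint of \<open>r\<close> and 1, hence below 1.\<close>
  define \<kappa> where "\<kappa> = (1 + 1 / r) / 2"
  have \<kappa>: "\<kappa> > 1" "\<kappa> * r = (1 + r) / 2"
    using r by (auto simp: \<kappa>_def field_simps)
  have "(\<Sum>n. ennreal (\<kappa> ^ Suc n) * transition_prob Pr \<Phi> (Suc n) x (space M)) < \<infinity>"
    if x: "x \<in> space M" for x
  proof -
    have "summable (\<lambda>n. (\<kappa> * r) ^ n)"
      using r by (intro summable_geometric) (simp add: \<kappa>)
    then have "summable (\<lambda>n. (\<kappa> * r) ^ Suc n)"
      using summable_Suc_iff[of "\<lambda>n. (\<kappa> * r) ^ n"] by simp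
    then have sum: "summable (\<lambda>n. (\<kappa> * r) ^ Suc n * W x)"
      by (rule summable_mult2)
    have "(\<Sum>n. ennreal (\<kappa> ^ Suc n) * transition_prob Pr \<Phi> (Suc n) x (space M)) \<le>
        (\<Sum>n. ennreal ((\<kappa> * r) ^ Suc n * W x))"
    proof (intro suminf_le summableI)
      fix n
      have "ennreal (\<kappa> ^ Suc n) * transition_prob Pr \<Phi> (Suc n) x (space M) \<le>
          ennreal (\<kappa> ^ Suc n) * ennreal (r ^ Suc n * W x)"
        unfolding transition_prob_eq_kernel_power[OF x] by (intro mult_left_mono bound x) simp
      also have "\<dots> = ennreal ((\<kappa> * r) ^ Suc n * W x)"
        using \<kappa>(1) by (subst ennreal_mult'[symmetric]) (auto simp: power_mult_distrib mult_ac)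
      finally show "ennreal (\<kappa> ^ Suc n) * transition_prob Pr \<Phi> (Suc n) x (space M) \<le>
          ennreal ((\<kappa> * r) ^ Suc n * W x)" .
    qed
    also have "\<dots> < \<infinity>"
      using sum \<kappa>(1) r W_ge[OF x] by (subst suminf_ennreal2) auto
    finally show ?thesis .
  qed
  then show ?thesis
    unfolding strongly_geometric_transient_def using \<kappa>(1) by blast
qed

end

theorem theorem2p11:
  fixes M :: "'a measure" and P :: "'a \<Rightarrow> 'a measure"
    and F :: "'w measure" and Pr :: "'a \<Rightarrow> 'w measure"
    and \<Phi> :: "nat \<Rightarrow> 'w \<Rightarrow> 'a option" and \<psi> :: "'a measure"
  assumes "countably_generated M"
    and "markov_chain M P F Pr \<Phi>"
    and "psi_irreducible M Pr \<Phi> \<psi>"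
    and "\<forall>x\<in>space M. measure (Pr x) {\<omega>\<in>space (Pr x). last_time M \<Phi> \<omega> < \<infinity>} = 1"
  shows "(strongly_geometric_transient M Pr \<Phi> \<longleftrightarrow>
           (\<exists>\<kappa>>1. \<forall>x\<in>space M. (\<integral>\<^sup>+\<omega>. enat_power \<kappa> (last_time M \<Phi> \<omega>) \<partial>Pr x) < \<infinity>))
       \<and> ((\<exists>\<kappa>>1. \<forall>x\<in>space M. (\<integral>\<^sup>+\<omega>. enat_power \<kappa> (last_time M \<Phi> \<omega>) \<partial>Pr x) < \<infinity>) \<longleftrightarrow>
           (\<exists>r::real. \<exists>W::'a \<Rightarrow> real.
              0 < r \<and> r < 1 \<and> W \<in> borel_measurable M \<and> (\<forall>x\<in>space M. 1 \<le> W x) \<and>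
              (\<forall>x\<in>space M. kernel_apply P (\<lambda>y. ennreal (W y)) x \<le> ennreal (r * W x))))"
proof -
  interpret markov M P F Pr \<Phi>
    using assms(2) by unfold_locales
  \<comment> \<open>Both equivalences are routed through strong geometric transience, so only its
    equivalence with the drift condition remains to be assembled.\<close>
  have "strongly_geometric_transient M Pr \<Phi> \<longleftrightarrow>
      (\<exists>r::real. \<exists>W::'a \<Rightarrow> real.
        0 < r \<and> r < 1 \<and> W \<in> borel_measurable M \<and> (\<forall>x\<in>space M. 1 \<le> W x) \<and>
        (\<forall>x\<in>space M. kernel_apply P (\<lambda>y. ennreal (W y)) x \<le> ennreal (r * W x)))"
    (is "_ \<longleftrightarrow> ?drift")
  proof
    assume "strongly_geometric_transient M Pr \<Phi>"
    then show ?drift by (rule drift_function_exists) blast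
  next
    assume ?drift
    then show "strongly_geometric_transient M Pr \<Phi>"
      by (blast intro: drift_imp_strongly_geometric_transient)
  qed
  then show ?thesis
    using strongly_geometric_transient_iff by simp
qed

end
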